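(* Let $m\ge2$ and $1\le i\le m$ be integers. Then $$\left(\sum_{j_1,\ldots,j_{i-1},j_{i+1},\ldots,j_m=1}^{\infty}\left(\sum_{j_i=1}^{\infty}\left|U(e_{j_1},\ldots,e_{j_m})\right|\right)^{2}\right)^{1/2}\le\left(\sqrt2\right)^{m-1}\|U\|$$ for all continuous real $m$-linear forms $U\colon c_0\times\cdots\times c_0\to\mathbb{R}$. Furthermore, $\left(\sqrt2\right)^{m-1}=C_{(2,2,\ldots,2,1)m}$ is the sharp constant.
   Context: $c_0$ is the real Banach space of real null sequences with the sup norm, $(e_j)$ its canonical basis, and $\|U\|$ is the usual sup norm of $U$ over the product of closed unit balls. $C_{(2,2,\ldots,2,1)m}$ denotes the optimal (smallest) constant $C$ such that $$\left(\sum_{j_1,\ldots,j_{m-1}=1}^{\infty}\left(\sum_{j_m=1}^{\infty}|U(e_{j_1},\ldots,e_{j_m})|\right)^{2}\right)^{1/2}\le C\|U\|$$ for all continuous $m$-linear forms $U\colon c_0\times\cdots\times c_0\to\mathbb{R}$. (By symmetry in the variables the optimal constant does not depend on which index is summed innermost.) *)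

theory Defs
  imports "HOL-Analysis.Analysis"
begin

section \<open>The real Banach space of null sequences\<close>

text \<open>Coordinates are numbered from \<open>0\<close>, so \<open>c0_unit 0\<close> is the first canonical basis vector.\<close>

typedef c0 = "{x :: nat \<Rightarrow> real. x \<longlonglongrightarrow> 0}"
  morphisms c0_nth Abs_c0
  by (rule exI[of _ "\<lambda>_. 0"]) simp

setup_lifting type_definition_c0

lemma c0_nth_tendsto: "c0_nth x \<longlonglongrightarrow> 0"
  using c0_nth[of x] by simp

lemma c0_eqI: "(\<And>j. c0_nth x j = c0_nth y j) \<Longrightarrow> x = y"
  by (simp add: c0_nth_inject[symmetric] fun_eq_iff)

instantiation c0 :: real_vector
begin

lift_definition zero_c0 :: c0 is "\<lambda>_. 0" by simp

lift_definition plus_c0 :: "c0 \<Rightarrow> c0 \<Rightarrow> c0" is "\<lambda>x y j. x j + y j"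
  by (rule tendsto_add_zero)

lift_definition minus_c0 :: "c0 \<Rightarrow> c0 \<Rightarrow> c0" is "\<lambda>x y j. x j - y j"
  using tendsto_diff by fastforce

lift_definition uminus_c0 :: "c0 \<Rightarrow> c0" is "\<lambda>x j. - x j"
  using tendsto_minus by fastforce

lift_definition scaleR_c0 :: "real \<Rightarrow> c0 \<Rightarrow> c0" is "\<lambda>r x j. r * x j"
  by (rule tendsto_mult_right_zero)

instance
  by standard (transfer; simp add: fun_eq_iff algebra_simps)+

end

lemmas c0_nth_simps [simp] =
  zero_c0.rep_eq plus_c0.rep_eq minus_c0.rep_eq uminus_c0.rep_eq scaleR_c0.rep_eq

lemma c0_bdd_above: "bdd_above (range (\<lambda>j. \<bar>c0_nth x j\<bar>))"
proof -
  have "Bseq (c0_nth x)"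
    using c0_nth_tendsto convergentI convergent_imp_Bseq by blast
  then obtain K where "\<And>j. norm (c0_nth x j) \<le> K"
    by (auto simp: Bseq_def)
  then show ?thesis
    by (intro bdd_aboveI[of _ K]) auto
qed

instantiation c0 :: real_normed_vector
begin

definition norm_c0 :: "c0 \<Rightarrow> real"
  where "norm_c0 x = (SUP j. \<bar>c0_nth x j\<bar>)"

definition sgn_c0 :: "c0 \<Rightarrow> c0"
  where "sgn_c0 x = x /\<^sub>R norm x"

definition dist_c0 :: "c0 \<Rightarrow> c0 \<Rightarrow> real"
  where "dist_c0 x y = norm (x - y)"

definition uniformity_c0 :: "(c0 \<times> c0) filter"
  where "uniformity_c0 = (INF e\<in>{0 <..}. principal {(x, y). dist x y < e})"

definition open_c0 :: "c0 set \<Rightarrow> bool"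
  where "open_c0 S = (\<forall>x\<in>S. \<forall>\<^sub>F (x', y) in uniformity. x' = x \<longrightarrow> y \<in> S)"

instance
proof
  fix x y :: c0 and r :: real
  have le: "\<bar>c0_nth z j\<bar> \<le> norm z" for z and j
    unfolding norm_c0_def by (rule cSUP_upper[OF UNIV_I c0_bdd_above])
  show "norm x = 0 \<longleftrightarrow> x = 0"
  proof
    assume "norm x = 0"
    with le[of x] show "x = 0"
      by (intro c0_eqI) simp
  next
    assume "x = 0"
    then show "norm x = 0"
      by (simp add: norm_c0_def)
  qed
  show "norm (x + y) \<le> norm x + norm y"
    unfolding norm_c0_def[of "x + y"]
  proof (rule cSUP_least)
    fix j
    show "\<bar>c0_nth (x + y) j\<bar> \<le> norm x + norm y"
      using le[of x j] le[of y j] by simp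
  qed simp
  have scale_le: "norm (s *\<^sub>R z) \<le> \<bar>s\<bar> * norm z" for s and z :: c0
    unfolding norm_c0_def[of "s *\<^sub>R z"]
  proof (rule cSUP_least)
    fix j
    show "\<bar>c0_nth (s *\<^sub>R z) j\<bar> \<le> \<bar>s\<bar> * norm z"
      using le[of z j] by (simp add: abs_mult mult_left_mono)
  qed simp
  show "norm (r *\<^sub>R x) = \<bar>r\<bar> * norm x"
  proof (cases "r = 0")
    case True
    then show ?thesis by (simp add: norm_c0_def)
  next
    case False
    have "norm x = norm (inverse r *\<^sub>R (r *\<^sub>R x))"
      using False by simp
    also have "\<dots> \<le> \<bar>inverse r\<bar> * norm (r *\<^sub>R x)"
      by (rule scale_le)
    finally have "\<bar>r\<bar> * norm x \<le> norm (r *\<^sub>R x)"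
      using False by (simp add: field_simps)
    with scale_le[of r x] show ?thesis by simp
  qed
qed (fact sgn_c0_def dist_c0_def uniformity_c0_def open_c0_def)+

end

lemma c0_nth_le_norm: "\<bar>c0_nth x j\<bar> \<le> norm x"
  unfolding norm_c0_def by (rule cSUP_upper[OF UNIV_I c0_bdd_above])

lemma norm_c0_le: "(\<And>j. \<bar>c0_nth x j\<bar> \<le> K) \<Longrightarrow> norm x \<le> K"
  unfolding norm_c0_def by (rule cSUP_least) auto

instance c0 :: banach
proof
  fix X :: "nat \<Rightarrow> c0"
  assume X: "Cauchy X"
  have diff: "\<bar>c0_nth (X m) j - c0_nth (X n) j\<bar> \<le> dist (X m) (X n)" for m n j
    using c0_nth_le_norm[of "X m - X n" j] by (simp add: dist_norm)
  have "Cauchy (\<lambda>n. c0_nth (X n) j)" for j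
    unfolding Cauchy_def dist_real_def using X diff
    by (meson Cauchy_def le_less_trans)
  then have "\<exists>l. \<forall>j. (\<lambda>n. c0_nth (X n) j) \<longlonglongrightarrow> l j"
    by (intro choice) (simp add: Cauchy_convergent convergent_def[symmetric])
  then obtain l where l: "\<And>j. (\<lambda>n. c0_nth (X n) j) \<longlonglongrightarrow> l j"
    by blast
  have unif: "\<exists>N. \<forall>n\<ge>N. \<forall>j. \<bar>c0_nth (X n) j - l j\<bar> \<le> e" if "e > 0" for e
  proof -
    from X that obtain N where N: "\<And>m n. m \<ge> N \<Longrightarrow> n \<ge> N \<Longrightarrow> dist (X m) (X n) < e"
      by (meson Cauchy_def)
    have "\<bar>c0_nth (X n) j - l j\<bar> \<le> e" if n: "n \<ge> N" for n j
    proof (rule tendsto_upperbound)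
      show "(\<lambda>m. \<bar>c0_nth (X n) j - c0_nth (X m) j\<bar>) \<longlonglongrightarrow> \<bar>c0_nth (X n) j - l j\<bar>"
        by (intro tendsto_intros l)
      show "\<forall>\<^sub>F m in sequentially. \<bar>c0_nth (X n) j - c0_nth (X m) j\<bar> \<le> e"
        using eventually_ge_at_top[of N]
      proof eventually_elim
        case (elim m)
        then show ?case using N[OF n elim] diff[of n j m] by linarith
      qed
    qed simp
    then show ?thesis by blast
  qed
  have "l \<longlonglongrightarrow> 0"
  proof (rule LIMSEQ_I)
    fix e :: real
    assume e: "e > 0"
    then obtain n where n: "\<And>j. \<bar>c0_nth (X n) j - l j\<bar> \<le> e / 2"
      using unif[of "e / 2"] by auto
    from LIMSEQ_D[OF c0_nth_tendsto, of "e / 2" "X n"] e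
    obtain J where J: "\<And>j. j \<ge> J \<Longrightarrow> \<bar>c0_nth (X n) j\<bar> < e / 2"
      by auto
    have "\<bar>l j\<bar> < e" if "j \<ge> J" for j
      using n[of j] J[OF that] by linarith
    then show "\<exists>J. \<forall>j\<ge>J. norm (l j - 0) < e"
      by auto
  qed
  then have nth_l: "c0_nth (Abs_c0 l) = l"
    by (simp add: Abs_c0_inverse)
  have "X \<longlonglongrightarrow> Abs_c0 l"
  proof (rule metric_LIMSEQ_I)
    fix e :: real
    assume e: "e > 0"
    then obtain N where N: "\<And>n j. n \<ge> N \<Longrightarrow> \<bar>c0_nth (X n) j - l j\<bar> \<le> e / 2"
      using unif[of "e / 2"] by auto
    have "dist (X n) (Abs_c0 l) < e" if "n \<ge> N" for n
    proof -
      have "dist (X n) (Abs_c0 l) \<le> e / 2"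
        unfolding dist_norm by (rule norm_c0_le) (use N[OF that] in \<open>simp add: nth_l\<close>)
      with e show ?thesis by linarith
    qed
    then show "\<exists>N. \<forall>n\<ge>N. dist (X n) (Abs_c0 l) < e"
      by blast
  qed
  then show "convergent X"
    by (rule convergentI)
qed

lift_definition c0_unit :: "nat \<Rightarrow> c0" is "\<lambda>n j. if j = n then 1 else 0"
  by (rule tendsto_eventually) (auto intro: eventually_sequentiallyI[of "Suc n" for n])


section \<open>Multilinear forms on \<open>c\<^sub>0\<close>\<close>

text \<open>
  An \<open>m\<close>-tuple of null sequences is an extensional function on \<open>{1..m}\<close>; the values of a form
  \<open>U\<close> outside \<open>{1..m} \<rightarrow>\<^sub>E UNIV\<close> are irrelevant.
\<close>

definition multilinear_form :: "nat \<Rightarrow> ((nat \<Rightarrow> c0) \<Rightarrow> real) \<Rightarrow> bool"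
  where "multilinear_form m U \<longleftrightarrow>
    (\<forall>x \<in> {1..m} \<rightarrow>\<^sub>E UNIV. \<forall>k \<in> {1..m}. linear (\<lambda>v. U (x(k := v))))"

definition continuous_multilinear_form :: "nat \<Rightarrow> ((nat \<Rightarrow> c0) \<Rightarrow> real) \<Rightarrow> bool"
  where "continuous_multilinear_form m U \<longleftrightarrow>
    multilinear_form m U \<and>
    continuous_map (product_topology (\<lambda>_. euclidean) {1..m}) euclideanreal U"

definition form_norm :: "nat \<Rightarrow> ((nat \<Rightarrow> c0) \<Rightarrow> real) \<Rightarrow> real"
  where "form_norm m U = (SUP x \<in> {1..m} \<rightarrow>\<^sub>E cball 0 1. \<bar>U x\<bar>)"

definition unit_tuple :: "nat \<Rightarrow> (nat \<Rightarrow> nat) \<Rightarrow> nat \<Rightarrow> c0"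
  where "unit_tuple m j = (\<lambda>k\<in>{1..m}. c0_unit (j k))"


section \<open>The mixed \<open>(\<ell>\<^sub>1, \<ell>\<^sub>2)\<close>-Littlewood inequality\<close>

definition inner_sum :: "nat \<Rightarrow> nat \<Rightarrow> ((nat \<Rightarrow> c0) \<Rightarrow> real) \<Rightarrow> (nat \<Rightarrow> nat) \<Rightarrow> real"
  where "inner_sum m i U j = (\<Sum>\<^sub>\<infinity>n\<in>UNIV. \<bar>U (unit_tuple m (j(i := n)))\<bar>)"

text \<open>
  A divergent real \<open>infsum\<close> is \<open>0\<close>, so an inequality between series of nonnegative terms has to
  assert convergence explicitly.  The outer sum ranges over the indices \<open>j k\<close> with
  \<open>k \<in> {1..m} - {i}\<close>.
\<close>

definition mixed_littlewood :: "nat \<Rightarrow> nat \<Rightarrow> real \<Rightarrow> ((nat \<Rightarrow> c0) \<Rightarrow> real) \<Rightarrow> bool"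
  where "mixed_littlewood m i C U \<longleftrightarrow>
    (\<forall>j \<in> ({1..m} - {i}) \<rightarrow>\<^sub>E UNIV. (\<lambda>n. \<bar>U (unit_tuple m (j(i := n)))\<bar>) summable_on UNIV) \<and>
    (\<lambda>j. (inner_sum m i U j)\<^sup>2) summable_on (({1..m} - {i}) \<rightarrow>\<^sub>E UNIV) \<and>
    sqrt (\<Sum>\<^sub>\<infinity>j \<in> ({1..m} - {i}) \<rightarrow>\<^sub>E UNIV. (inner_sum m i U j)\<^sup>2) \<le> C * form_norm m U"

text \<open>
  The constant \<open>C\<^bsub>(2,\<dots>,2,1)m\<^esub>\<close> is the case \<open>i = m\<close>; the other \<open>i\<close> give the same number.
\<close>

definition optimal_constant :: "nat \<Rightarrow> nat \<Rightarrow> real"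
  where "optimal_constant m i =
    (LEAST C. \<forall>U. continuous_multilinear_form m U \<longrightarrow> mixed_littlewood m i C U)"

end

theory Submission
  imports Defs
begin

text \<open>
  Upper bound.  The heart of the matter is the \<open>L\<^sub>1\<close>--\<open>L\<^sub>2\<close> Khinchine inequality with its best
  constant, \<open>sqrt (\<Sum> a\<^sub>j\<^sup>2) \<le> sqrt 2 * E \<bar>\<Sum> \<epsilon>\<^sub>j a\<^sub>j\<bar>\<close> for independent random signs \<open>\<epsilon>\<^sub>j\<close>
  (\<open>khinchine_L1_L2\<close>).  Fix \<open>i\<close> and put \<open>F x = \<Sum>\<^sub>n \<bar>U (x(i := e\<^sub>n))\<bar>\<close>, a seminorm in each of the
  other coordinates.  On tuples from the unit ball \<open>F\<close> is bounded by the norm of \<open>U\<close>, since the signs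
  of the terms can be moved into the \<open>i\<close>-th argument (\<open>sum_units_le_form_norm\<close>).  As \<open>F\<close> is an
  \<open>\<ell>\<^sub>1\<close>-norm of linear functions, Khinchine's inequality carries over to it: replacing the
  \<open>\<ell>\<^sub>2\<close>-sum over the basis vectors in one coordinate by an average over the vectors
  \<open>\<Sum> \<epsilon>\<^sub>j e\<^sub>j\<close>, which still lie in the unit ball, costs a factor \<open>sqrt 2\<close> (\<open>L1_valued_khinchine\<close>).
  Doing this in the \<open>m - 1\<close> coordinates other than \<open>i\<close>, one after the other, costs
  \<open>sqrt 2 ^ (m - 1)\<close> (\<open>finite_mixed_littlewood\<close>); Minkowski's inequality takes the average out of the
  \<open>\<ell>\<^sub>2\<close>-sums over the coordinates that have not yet been treated.

  Khinchine's inequality is proved by the argument of Latala and Oleszkiewicz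
  (\<open>khinchine_kahane\<close>).  Let \<open>f(\<epsilon>)\<close> be the norm of \<open>\<Sum> \<epsilon>\<^sub>j a\<^sub>j\<close> and \<open>L\<close> the Laplacian of the
  discrete cube, whose eigenvalue at the Walsh function of a set \<open>A\<close> is \<open>card A\<close>.  As \<open>f\<close> is
  even, it has no component at level one, so the spectral gap doubles:
  \<open>2 (E f\<^sup>2 - (E f)\<^sup>2) \<le> E (f L f)\<close>.  On the other hand the triangle inequality gives
  \<open>L f \<le> f\<close>.  Together, \<open>E f\<^sup>2 \<le> 2 (E f)\<^sup>2\<close>.

  Sharpness.  Take the \<open>2 ^ (m - 1)\<close> sign patterns \<open>\<epsilon>\<close> on the coordinates \<open>k \<noteq> i\<close> as indices for
  the \<open>i\<close>-th argument, and let \<open>U x\<close> be the sum over \<open>\<epsilon>\<close> of \<open>x\<^sub>i(\<epsilon>)\<close> times the product of the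
  factors \<open>x\<^sub>k(0) + \<epsilon>\<^sub>k x\<^sub>k(1)\<close> (\<open>hypercube_form\<close>).  On the unit ball \<open>\<bar>U x\<bar>\<close> is at most the product
  of \<open>\<bar>a - b\<bar> + \<bar>a + b\<bar> = 2 max(\<bar>a\<bar>, \<bar>b\<bar>) \<le> 2\<close> with \<open>a = x\<^sub>k(0)\<close> and \<open>b = x\<^sub>k(1)\<close>, thus at most
  \<open>2 ^ (m - 1)\<close>; but each of the \<open>2 ^ (m - 1)\<close> inner sums with indices in \<open>{0, 1}\<close> equals \<open>2 ^ (m - 1)\<close>.
\<close>

section \<open>Averages over random signs\<close>

text \<open>
  Expectation over \<open>n\<close> independent uniform signs.  The recursion on the last sign makes the
  inequalities below provable by induction on \<open>n\<close>.  Entries from \<open>n\<close> on are \<open>0\<close>, so the average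
  is taken over \<open>sign_vectors n\<close>.
\<close>

fun rademacher_mean :: "nat \<Rightarrow> ((nat \<Rightarrow> real) \<Rightarrow> real) \<Rightarrow> real" where
  "rademacher_mean 0 f = f (\<lambda>_. 0)"
| "rademacher_mean (Suc n) f =
    (rademacher_mean n (\<lambda>s. f (s(n := 1))) + rademacher_mean n (\<lambda>s. f (s(n := - 1)))) / 2"

abbreviation sign_vectors :: "nat \<Rightarrow> (nat \<Rightarrow> real) set" where
  "sign_vectors n \<equiv> {s. (\<forall>j<n. \<bar>s j\<bar> = 1) \<and> (\<forall>j\<ge>n. s j = 0)}"

lemma rademacher_mean_mono:
  "(\<And>s. s \<in> sign_vectors n \<Longrightarrow> f s \<le> g s) \<Longrightarrow> rademacher_mean n f \<le> rademacher_mean n g"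
proof (induction n arbitrary: f g)
  case 0
  from 0[of "\<lambda>_. 0"] show ?case by simp
next
  case (Suc n)
  have *: "s(n := c) \<in> sign_vectors (Suc n)" if "s \<in> sign_vectors n" "\<bar>c\<bar> = 1" for s c
    using that by (auto simp: less_Suc_eq)
  have "rademacher_mean n (\<lambda>s. f (s(n := c))) \<le> rademacher_mean n (\<lambda>s. g (s(n := c)))"
    if "\<bar>c\<bar> = 1" for c
    using that by (intro Suc.IH Suc.prems *) auto
  from this[of 1] this[of "- 1"] show ?case by simp
qed

lemma rademacher_mean_cong:
  assumes "\<And>s. s \<in> sign_vectors n \<Longrightarrow> f s = g s"
  shows "rademacher_mean n f = rademacher_mean n g"
  by (intro antisym rademacher_mean_mono) (use assms in auto)

lemma rademacher_mean_const [simp]: "rademacher_mean n (\<lambda>_. c) = c"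
  by (induction n) auto

lemma rademacher_mean_add:
  "rademacher_mean n (\<lambda>s. f s + g s) = rademacher_mean n f + rademacher_mean n g"
  by (induction n arbitrary: f g) (auto simp: field_simps)

lemma rademacher_mean_cmult:
  "rademacher_mean n (\<lambda>s. c * f s) = c * rademacher_mean n f"
  by (induction n arbitrary: f) (auto simp: field_simps)

lemma rademacher_mean_diff:
  "rademacher_mean n (\<lambda>s. f s - g s) = rademacher_mean n f - rademacher_mean n g"
  using rademacher_mean_add[of n f "\<lambda>s. - 1 * g s"] rademacher_mean_cmult[of n "- 1" g] by simp

lemma rademacher_mean_sum:
  "rademacher_mean n (\<lambda>s. \<Sum>x\<in>A. f x s) = (\<Sum>x\<in>A. rademacher_mean n (f x))"
  by (induction A rule: infinite_finite_induct) (auto simp: rademacher_mean_add)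

lemma rademacher_mean_reflect:
  "rademacher_mean n (\<lambda>s. f (- s)) = rademacher_mean n f"
proof (induction n arbitrary: f)
  case 0
  then show ?case by (simp add: fun_Compl_def)
next
  case (Suc n)
  have "rademacher_mean n (\<lambda>s. f (- (s(n := c)))) = rademacher_mean n (\<lambda>s. f (s(n := - c)))" for c
  proof -
    have "- (s(n := c)) = (- s)(n := - c)" for s :: "nat \<Rightarrow> real"
      by auto
    then show ?thesis
      using Suc.IH[of "\<lambda>s. f (s(n := - c))"] by (simp only:)
  qed
  from this[of 1] this[of "- 1"] show ?case
    by (simp only: rademacher_mean.simps minus_minus add.commute)
qed

lemma rademacher_mean_square_nonneg:
  "rademacher_mean n (\<lambda>s. (f s)\<^sup>2) \<ge> 0" 
  using rademacher_mean_mono[of n "\<lambda>_. 0" "\<lambda>s. (f s)\<^sup>2"] by simp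

section \<open>The Poincare inequality on the discrete cube\<close>

text \<open>
  This is \<open>E (f L f)\<close>, where \<open>L f s\<close> is half the sum of \<open>f s - f s'\<close> over the \<open>n\<close> neighbours
  \<open>s'\<close> of \<open>s\<close>.
\<close>

definition dirichlet_form :: "nat \<Rightarrow> ((nat \<Rightarrow> real) \<Rightarrow> real) \<Rightarrow> real" where
  "dirichlet_form n f =
    (\<Sum>i<n. rademacher_mean n (\<lambda>s. f s * (f s - f (s(i := - s i))))) / 2"

text \<open>
  As a function of the sign \<open>s n\<close>, every \<open>f\<close> is affine: \<open>f s = even_part n f s + s n * odd_part n f s\<close>.
  Neither part depends on \<open>s n\<close>, and in the Walsh expansion of \<open>f\<close> the second one collects the
  sets that contain \<open>n\<close>.
\<close>

definition even_part :: "nat \<Rightarrow> ((nat \<Rightarrow> real) \<Rightarrow> real) \<Rightarrow> (nat \<Rightarrow> real) \<Rightarrow> real" where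
  "even_part n f s = (f (s(n := 1)) + f (s(n := - 1))) / 2"

definition odd_part :: "nat \<Rightarrow> ((nat \<Rightarrow> real) \<Rightarrow> real) \<Rightarrow> (nat \<Rightarrow> real) \<Rightarrow> real" where
  "odd_part n f s = (f (s(n := 1)) - f (s(n := - 1))) / 2"

text \<open>
  Conditioning on the last sign.  By orthogonality the mixed terms in \<open>even_part\<close> and \<open>odd_part\<close>
  cancel; the last summand of \<open>dirichlet_form_split\<close> is the contribution of flipping the sign
  \<open>s n\<close>.
\<close>

lemma
  fixes f :: "(nat \<Rightarrow> real) \<Rightarrow> real" and n :: nat
  defines "g \<equiv> even_part n f" and "h \<equiv> odd_part n f"
  shows mean_split: "rademacher_mean (Suc n) f = rademacher_mean n g"
    and mean_square_split: "rademacher_mean (Suc n) (\<lambda>s. (f s)\<^sup>2)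
          = rademacher_mean n (\<lambda>s. (g s)\<^sup>2) + rademacher_mean n (\<lambda>s. (h s)\<^sup>2)"
    and coefficient_split: "(\<Sum>i<Suc n. (rademacher_mean (Suc n) (\<lambda>s. f s * s i))\<^sup>2)
          = (\<Sum>i<n. (rademacher_mean n (\<lambda>s. g s * s i))\<^sup>2) + (rademacher_mean n h)\<^sup>2"
    and dirichlet_form_split: "dirichlet_form (Suc n) f
          = dirichlet_form n g + dirichlet_form n h + rademacher_mean n (\<lambda>s. (h s)\<^sup>2)"
proof -
  let ?E = "rademacher_mean n"
  note g_def = g_def even_part_def[abs_def] and h_def = h_def odd_part_def[abs_def]
  have half: "?E (\<lambda>s. (p s + q s) / 2) = (?E p + ?E q) / 2" for p q
    using rademacher_mean_cmult[of n "1/2" "\<lambda>s. p s + q s"] rademacher_mean_add[of n p q] by simp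
  have half': "?E (\<lambda>s. (p s - q s) / 2) = (?E p - ?E q) / 2" for p q
    using rademacher_mean_cmult[of n "1/2" "\<lambda>s. p s - q s"] rademacher_mean_diff[of n p q] by simp
  show "rademacher_mean (Suc n) f = ?E g"
    unfolding g_def half by simp
  show "rademacher_mean (Suc n) (\<lambda>s. (f s)\<^sup>2) = ?E (\<lambda>s. (g s)\<^sup>2) + ?E (\<lambda>s. (h s)\<^sup>2)"
    unfolding rademacher_mean.simps half[symmetric]
    unfolding rademacher_mean_add[symmetric]
    by (rule rademacher_mean_cong) (simp add: g_def h_def power2_eq_square field_simps)
  have "rademacher_mean (Suc n) (\<lambda>s. f s * s i) = ?E (\<lambda>s. g s * s i)" if "i < n" for i
    unfolding rademacher_mean.simps half[symmetric]
    by (rule rademacher_mean_cong) (use that in \<open>simp add: g_def field_simps\<close>)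
  moreover have "rademacher_mean (Suc n) (\<lambda>s. f s * s n) = ?E h"
    unfolding rademacher_mean.simps half[symmetric]
    by (rule rademacher_mean_cong) (simp add: h_def field_simps)
  ultimately show "(\<Sum>i<Suc n. (rademacher_mean (Suc n) (\<lambda>s. f s * s i))\<^sup>2)
      = (\<Sum>i<n. (?E (\<lambda>s. g s * s i))\<^sup>2) + (?E h)\<^sup>2"
    by (simp del: rademacher_mean.simps)
  have "rademacher_mean (Suc n) (\<lambda>s. f s * (f s - f (s(i := - s i))))
      = ?E (\<lambda>s. g s * (g s - g (s(i := - s i)))) + ?E (\<lambda>s. h s * (h s - h (s(i := - s i))))"
    if "i < n" for i
    unfolding rademacher_mean.simps half[symmetric]
    unfolding rademacher_mean_add[symmetric]
    by (rule rademacher_mean_cong)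
      (use that in \<open>simp add: g_def h_def fun_upd_twist[of n i] field_simps\<close>)
  moreover have "rademacher_mean (Suc n) (\<lambda>s. f s * (f s - f (s(n := - s n))))
      = 2 * ?E (\<lambda>s. (h s)\<^sup>2)"
    unfolding rademacher_mean.simps half[symmetric] rademacher_mean_cmult[symmetric]
    by (rule rademacher_mean_cong) (simp add: h_def power2_eq_square field_simps)
  ultimately show "dirichlet_form (Suc n) f
      = dirichlet_form n g + dirichlet_form n h + ?E (\<lambda>s. (h s)\<^sup>2)"
    by (simp add: dirichlet_form_def sum.distrib field_simps del: rademacher_mean.simps)
qed

lemma dirichlet_form_nonneg: "dirichlet_form n f \<ge> 0"
proof (induction n arbitrary: f)
  case 0
  then show ?case by (simp add: dirichlet_form_def)
next
  case (Suc n)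
  then show ?case
    unfolding dirichlet_form_split by (intro add_nonneg_nonneg rademacher_mean_square_nonneg)
qed

lemma poincare_cube:
  "rademacher_mean n (\<lambda>s. (f s)\<^sup>2) - (rademacher_mean n f)\<^sup>2 \<le> dirichlet_form n f"
proof (induction n arbitrary: f)
  case 0
  then show ?case by (simp add: dirichlet_form_def)
next
  case (Suc n)
  show ?case
    using Suc.IH[of "even_part n f"] dirichlet_form_nonneg[of n "odd_part n f"]
    unfolding mean_square_split mean_split[of n f] dirichlet_form_split by linarith
qed

text \<open>
  At the Walsh function of a set \<open>A\<close> this says \<open>1 \<le> (card A + of_bool (card A = 1)) / 2\<close>
  for \<open>A \<noteq> {}\<close>: once the level-one coefficients are added, the smallest nonzero eigenvalue is \<open>2\<close>.  The
  constant coefficient of \<open>odd_part n f\<close> is a level-one coefficient of \<open>f\<close>, which is why the plain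
  Poincare inequality for \<open>odd_part n f\<close> suffices in the induction.
\<close>

lemma poincare_cube_level_one:
  "rademacher_mean n (\<lambda>s. (f s)\<^sup>2) - (rademacher_mean n f)\<^sup>2
    \<le> (dirichlet_form n f + (\<Sum>i<n. (rademacher_mean n (\<lambda>s. f s * s i))\<^sup>2)) / 2"
proof (induction n arbitrary: f)
  case 0
  then show ?case by (simp add: dirichlet_form_def)
next
  case (Suc n)
  show ?case
    using Suc.IH[of "even_part n f"] poincare_cube[of n "odd_part n f"]
    unfolding mean_square_split mean_split[of n f] dirichlet_form_split coefficient_split
    by argo
qed

section \<open>Khinchine inequalities with constant \<open>sqrt 2\<close>\<close>

text \<open>
  The norm of a Rademacher sum is an even function of the signs, hence has no level-one
  coefficients.  Its Dirichlet form is at most its second moment: the values of the Rademacher sum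
  at the \<open>n\<close> neighbours of \<open>s\<close> add up to \<open>n - 2\<close> times its value at \<open>s\<close>, so by the triangle
  inequality their norms add up to at least \<open>n - 2\<close> times the norm at \<open>s\<close>.
\<close>

theorem khinchine_kahane:
  fixes a :: "nat \<Rightarrow> 'a::real_normed_vector"
  shows "rademacher_mean n (\<lambda>s. (norm (\<Sum>j<n. s j *\<^sub>R a j))\<^sup>2)
    \<le> 2 * (rademacher_mean n (\<lambda>s. norm (\<Sum>j<n. s j *\<^sub>R a j)))\<^sup>2"
proof -
  define S where "S s = (\<Sum>j<n. s j *\<^sub>R a j)" for s :: "nat \<Rightarrow> real"
  define f where "f s = norm (S s)" for s
  \<comment> \<open>each \<open>s j\<close> keeps its sign in \<open>n - 1\<close> of the neighbours and changes it in one\<close>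
  have flip: "(\<Sum>i<n. S (s(i := - s i))) = (real n - 2) *\<^sub>R S s" for s
  proof -
    have "S (s(i := - s i)) = S s - 2 *\<^sub>R (s i *\<^sub>R a i)" if "i < n" for i
    proof -
      have "S (s(i := - s i)) = (\<Sum>j<n. s j *\<^sub>R a j - (if j = i then 2 *\<^sub>R (s i *\<^sub>R a i) else 0))"
        unfolding S_def by (rule sum.cong) (auto simp: algebra_simps simp flip: scaleR_2)
      then show ?thesis
        using that by (simp add: sum_subtractf S_def)
    qed
    then have "(\<Sum>i<n. S (s(i := - s i))) = (\<Sum>i<n. S s - 2 *\<^sub>R (s i *\<^sub>R a i))"
      by simp
    also have "\<dots> = real n *\<^sub>R S s - 2 *\<^sub>R S s"
      by (simp only: sum_subtractf scaleR_sum_right[symmetric] S_def sum_constant_scaleR card_lessThan)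
    finally show ?thesis
      by (simp only: scaleR_left_diff_distrib)
  qed
  \<comment> \<open>the pointwise inequality \<open>L f \<le> f\<close>, multiplied by \<open>2 f\<close>\<close>
  have local_bound: "(\<Sum>i<n. f s * (f s - f (s(i := - s i)))) \<le> 2 * (f s)\<^sup>2" for s
  proof -
    have "(real n - 2) * f s \<le> norm (\<Sum>i<n. S (s(i := - s i)))"
      unfolding flip f_def by (simp add: mult_right_mono)
    also have "\<dots> \<le> (\<Sum>i<n. f (s(i := - s i)))"
      unfolding f_def by (rule norm_sum)
    finally have "f s * (real n * f s - (\<Sum>i<n. f (s(i := - s i)))) \<le> f s * (2 * f s)"
      by (intro mult_left_mono) (auto simp: f_def algebra_simps)
    then show ?thesis
      by (simp add: sum_distrib_left[symmetric] sum_subtractf power2_eq_square)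
  qed
  have "dirichlet_form n f \<le> rademacher_mean n (\<lambda>s. (f s)\<^sup>2)"
    using rademacher_mean_mono[of n "\<lambda>s. \<Sum>i<n. f s * (f s - f (s(i := - s i)))" "\<lambda>s. 2 * (f s)\<^sup>2"]
      local_bound
    by (simp add: dirichlet_form_def rademacher_mean_sum rademacher_mean_cmult)
  moreover have "rademacher_mean n (\<lambda>s. f s * s i) = 0" for i
  proof -
    have "f (- s) = f s" for s
      by (simp add: f_def S_def sum_negf)
    then have "rademacher_mean n (\<lambda>s. f s * s i) = - rademacher_mean n (\<lambda>s. f s * s i)"
      using rademacher_mean_reflect[of n "\<lambda>s. f s * s i"]
        rademacher_mean_cmult[of n "- 1" "\<lambda>s. f s * s i"] by simp
    then show ?thesis by simp
  qed
  ultimately show ?thesis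
    using poincare_cube_level_one[of n f] by (simp add: f_def[abs_def] S_def)
qed

lemma rademacher_mean_sum_square:
  "rademacher_mean n (\<lambda>s. (\<Sum>j<n. s j * a j)\<^sup>2) = (\<Sum>j<n. (a j)\<^sup>2)"
proof (induction n)
  case 0
  then show ?case by simp
next
  case (Suc n)
  have "rademacher_mean (Suc n) (\<lambda>s. (\<Sum>j<Suc n. s j * a j)\<^sup>2)
      = rademacher_mean n (\<lambda>s. ((\<Sum>j<n. s j * a j) + a n)\<^sup>2 / 2 + ((\<Sum>j<n. s j * a j) - a n)\<^sup>2 / 2)"
    using rademacher_mean_cmult[of n "1/2" "\<lambda>s. ((\<Sum>j<n. s j * a j) + a n)\<^sup>2"]
     rademacher_mean_cmult[of n "1/2" "\<lambda>s. ((\<Sum>j<n. s j * a j) - a n)\<^sup>2"]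
    by (simp add: rademacher_mean_add)
  also have "\<dots> = rademacher_mean n (\<lambda>s. (\<Sum>j<n. s j * a j)\<^sup>2 + (a n)\<^sup>2)"
    by (rule rademacher_mean_cong) (simp add: power2_eq_square field_simps)
  finally show ?case
    using Suc.IH by (simp add: rademacher_mean_add)
qed

corollary khinchine_L1_L2:
  "L2_set a {..<n} \<le> sqrt 2 * rademacher_mean n (\<lambda>s. \<bar>\<Sum>j<n. s j * a j\<bar>)"
proof -
  have "(\<Sum>j<n. (a j)\<^sup>2) \<le> 2 * (rademacher_mean n (\<lambda>s. \<bar>\<Sum>j<n. s j * a j\<bar>))\<^sup>2"
    using khinchine_kahane[of n a] by (simp add: rademacher_mean_sum_square)
  moreover have "rademacher_mean n (\<lambda>s. \<bar>\<Sum>j<n. s j * a j\<bar>) \<ge> 0"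
    using rademacher_mean_mono[of n "\<lambda>_. 0"] by simp
  ultimately show ?thesis
    unfolding L2_set_def by (intro real_le_lsqrt) (auto simp: power_mult_distrib sum_nonneg)
qed

text \<open>
  Minkowski's inequality, with an average over signs in place of a sum of two vectors.
\<close>

lemma L2_set_rademacher_mean_le:
  "L2_set (\<lambda>x. rademacher_mean n (f x)) A \<le> rademacher_mean n (\<lambda>s. L2_set (\<lambda>x. f x s) A)"
proof (induction n arbitrary: f)
  case 0
  then show ?case by simp
next
  case (Suc n)
  have "L2_set (\<lambda>x. rademacher_mean (Suc n) (f x)) A
      = 1/2 * L2_set (\<lambda>x. rademacher_mean n (\<lambda>s. f x (s(n := 1)))
              + rademacher_mean n (\<lambda>s. f x (s(n := - 1)))) A"
    by (subst L2_set_right_distrib) auto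
  also have "\<dots> \<le> 1/2 * (L2_set (\<lambda>x. rademacher_mean n (\<lambda>s. f x (s(n := 1)))) A
              + L2_set (\<lambda>x. rademacher_mean n (\<lambda>s. f x (s(n := - 1)))) A)"
    by (intro mult_left_mono L2_set_triangle_ineq) auto
  also have "\<dots> \<le> rademacher_mean (Suc n) (\<lambda>s. L2_set (\<lambda>x. f x s) A)"
    using Suc.IH[of "\<lambda>x s. f x (s(n := 1))"] Suc.IH[of "\<lambda>x s. f x (s(n := - 1))"] by simp
  finally show ?case .
qed

lemma L2_set_sum_le:
  "L2_set (\<lambda>x. \<Sum>y\<in>B. f y x) A \<le> (\<Sum>y\<in>B. L2_set (f y) A)"
proof (induction B rule: infinite_finite_induct)
  case (insert y B)
  then show ?case
    using L2_set_triangle_ineq[of "f y" "\<lambda>x. \<Sum>y\<in>B. f y x" A] by simp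
qed (auto simp: L2_set_def)

text \<open>
  Khinchine's inequality survives an inner \<open>\<ell>\<^sub>1\<close>-norm: Minkowski's inequality first moves the sum
  over \<open>B\<close> outside the \<open>\<ell>\<^sub>2\<close>-norm, then Khinchine's inequality applies for each \<open>y\<close>.  For a general
  norm in place of the \<open>\<ell>\<^sub>1\<close>-norm this would fail.
\<close>

lemma L1_valued_khinchine:
  "L2_set (\<lambda>l. \<Sum>y\<in>B. \<bar>a l y\<bar>) {..<p}
    \<le> sqrt 2 * rademacher_mean p (\<lambda>s. \<Sum>y\<in>B. \<bar>\<Sum>l<p. s l * a l y\<bar>)"
proof -
  have "L2_set (\<lambda>l. \<Sum>y\<in>B. \<bar>a l y\<bar>) {..<p} \<le> (\<Sum>y\<in>B. L2_set (\<lambda>l. a l y) {..<p})"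
    using L2_set_sum_le[where B = B and f = "\<lambda>y l. \<bar>a l y\<bar>"] by (simp add: L2_set_def)
  also have "\<dots> \<le> (\<Sum>y\<in>B. sqrt 2 * rademacher_mean p (\<lambda>s. \<bar>\<Sum>l<p. s l * a l y\<bar>))"
    by (intro sum_mono khinchine_L1_L2)
  finally show ?thesis
    by (simp add: rademacher_mean_sum sum_distrib_left)
qed

section \<open>Continuous multilinear forms on \<open>c\<^sub>0\<close>\<close>

lemma c0_nth_unit [simp]: "c0_nth (c0_unit n) j = (if j = n then 1 else 0)"
  by (simp add: c0_unit.rep_eq)

lemma c0_nth_sum [simp]: "c0_nth (\<Sum>x\<in>A. v x) j = (\<Sum>x\<in>A. c0_nth (v x) j)"
  by (induction A rule: infinite_finite_induct) auto

lemma norm_c0_unit_le: "norm (c0_unit n) \<le> 1"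
  by (rule norm_c0_le) simp

lemma norm_unit_combination_le:
  assumes "\<And>j. j < n \<Longrightarrow> \<bar>s j\<bar> \<le> 1"
  shows "norm (\<Sum>j<n. s j *\<^sub>R c0_unit j) \<le> 1"
proof (rule norm_c0_le)
  fix k
  have "c0_nth (\<Sum>j<n. s j *\<^sub>R c0_unit j) k = (\<Sum>j<n. if k = j then s j else 0)"
    by (simp add: if_distrib cong: if_cong)
  also have "\<dots> = (if k < n then s k else 0)"
    by simp
  finally show "\<bar>c0_nth (\<Sum>j<n. s j *\<^sub>R c0_unit j) k\<bar> \<le> 1"
    using assms by simp
qed

abbreviation unit_ball_tuples :: "nat \<Rightarrow> (nat \<Rightarrow> c0) set" where
  "unit_ball_tuples m \<equiv> {1..m} \<rightarrow>\<^sub>E cball 0 1"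

lemma multilinear_form_linear:
  assumes "multilinear_form m U" "x \<in> {1..m} \<rightarrow>\<^sub>E UNIV" "k \<in> {1..m}"
  shows "linear (\<lambda>v. U (x(k := v)))"
  using assms by (auto simp: multilinear_form_def)

lemma multilinear_form_unit_combination:
  assumes "multilinear_form m U" "x \<in> {1..m} \<rightarrow>\<^sub>E UNIV" "k \<in> {1..m}"
  shows "U (x(k := \<Sum>j<n. s j *\<^sub>R c0_unit j)) = (\<Sum>j<n. s j * U (x(k := c0_unit j)))"
proof -
  interpret linear "\<lambda>v. U (x(k := v))"
    by (rule multilinear_form_linear[OF assms])
  show ?thesis
    by (simp add: sum scale)
qed

lemma fun_upd_in_PiE:
  assumes "x \<in> I \<rightarrow>\<^sub>E S" "k \<in> I" "v \<in> S"
  shows "x(k := v) \<in> I \<rightarrow>\<^sub>E S"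
  using assms by (auto simp: PiE_iff extensional_def)

lemma multilinear_form_scale:
  assumes U: "multilinear_form m U" and x: "x \<in> {1..m} \<rightarrow>\<^sub>E UNIV" and K: "K \<subseteq> {1..m}"
  shows "U (\<lambda>k. if k \<in> K then c *\<^sub>R x k else x k) = c ^ card K * U x"
proof -
  have "finite K" using K finite_subset by blast
  then show ?thesis using K
  proof (induction K)
    case (insert a K)
    define y where "y = (\<lambda>k. if k \<in> K then c *\<^sub>R x k else x k)"
    have y: "y \<in> {1..m} \<rightarrow>\<^sub>E UNIV"
      using insert.prems x by (auto simp: y_def PiE_iff extensional_def)
    interpret linear "\<lambda>v. U (y(a := v))"
      by (rule multilinear_form_linear[OF U y]) (use insert.prems in auto)
    have "(\<lambda>k. if k \<in> insert a K then c *\<^sub>R x k else x k) = y(a := c *\<^sub>R y a)"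
      using insert.hyps by (auto simp: y_def)
    then show ?case
      using insert scale[of c "y a"] by (simp add: y_def[symmetric])
  qed simp
qed

text \<open>
  \<open>U\<close> vanishes at the zero tuple, so by continuity \<open>\<bar>U\<bar> \<le> 1\<close> on all tuples from a ball of some
  radius \<open>d\<close>; scaling all \<open>m\<close> arguments by \<open>d\<close> yields the bound \<open>1 / d ^ m\<close> on unit balls.  Without
  this, the supremum in \<open>form_norm\<close> would be meaningless.
\<close>

lemma bdd_above_continuous_multilinear_form:
  assumes U: "continuous_multilinear_form m U" and m: "m \<ge> 1"
  shows "bdd_above ((\<lambda>x. \<bar>U x\<bar>) ` unit_ball_tuples m)"
proof -
  let ?X = "product_topology (\<lambda>_. euclidean) {1..m} :: (nat \<Rightarrow> c0) topology"
  define z :: "nat \<Rightarrow> c0" where "z = (\<lambda>k\<in>{1..m}. 0)"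
  have ml: "multilinear_form m U" and cont: "continuous_map ?X euclideanreal U"
    using U by (auto simp: continuous_multilinear_form_def)
  have z: "z \<in> {1..m} \<rightarrow>\<^sub>E UNIV"
    by (simp add: z_def)
  have "U (z(1 := 0)) = 0"
    by (rule linear_0[OF multilinear_form_linear[OF ml z]]) (use m in auto)
  moreover have "z(1 := 0) = z"
    using m by (auto simp: z_def)
  ultimately have Uz: "U z = 0" by simp
  define S where "S = {x \<in> topspace ?X. U x \<in> {-1<..<1}}"
  have "openin ?X S"
    unfolding S_def by (rule openin_continuous_map_preimage[OF cont]) auto
  moreover have "z \<in> S"
    using z Uz by (simp add: S_def)
  ultimately have "\<exists>W. (\<forall>k\<in>{1..m}. openin euclidean (W k)) \<and> z \<in> Pi\<^sub>E {1..m} W \<and> Pi\<^sub>E {1..m} W \<subseteq> S"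
    unfolding openin_product_topology_alt by blast
  then obtain W where W: "\<And>k. k \<in> {1..m} \<Longrightarrow> openin euclidean (W k)" "z \<in> Pi\<^sub>E {1..m} W" "Pi\<^sub>E {1..m} W \<subseteq> S"
    by blast
  have "\<forall>k\<in>{1..m}. \<exists>e>0. cball 0 e \<subseteq> W k"
  proof
    fix k assume k: "k \<in> {1..m}"
    then have "0 \<in> W k"
      using W(2) by (auto simp: PiE_iff z_def)
    moreover have "open (W k)"
      using W(1)[OF k] by (simp only: open_openin)
    ultimately show "\<exists>e>0. cball 0 e \<subseteq> W k"
      using open_contains_cball by blast
  qed
  then obtain e where e: "\<And>k. k \<in> {1..m} \<Longrightarrow> e k > 0" "\<And>k. k \<in> {1..m} \<Longrightarrow> cball 0 (e k) \<subseteq> W k"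
    by metis
  define d where "d = Min (e ` {1..m})"
  have d: "d > 0" "\<And>k. k \<in> {1..m} \<Longrightarrow> d \<le> e k"
    using e(1) m by (auto simp: d_def)
  have "\<bar>U x\<bar> \<le> 1 / d ^ m" if x: "x \<in> unit_ball_tuples m" for x
  proof -
    let ?y = "\<lambda>k. if k \<in> {1..m} then d *\<^sub>R x k else x k"
    have "?y k \<in> W k" if k: "k \<in> {1..m}" for k
    proof -
      have "norm (x k) \<le> 1"
        using x k by (auto simp: PiE_iff)
      then have "d * norm (x k) \<le> e k"
        using d(1) d(2)[OF k] mult_left_le[of "norm (x k)" d] by linarith
      then show ?thesis
        using e(2)[OF k] d(1) k by auto
    qed
    then have "?y \<in> S"
      using W(3) x by (auto simp: PiE_iff extensional_def)
    moreover have "U ?y = d ^ m * U x"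
      using multilinear_form_scale[OF ml _ subset_refl, of x d] x by (auto simp: PiE_iff)
    ultimately have "\<bar>d ^ m * U x\<bar> \<le> 1"
      by (auto simp: S_def)
    then show ?thesis
      using d(1) by (simp add: abs_mult field_simps)
  qed
  then show ?thesis
    by (intro bdd_aboveI2)
qed

lemma form_norm_upper:
  assumes "continuous_multilinear_form m U" "m \<ge> 1" "x \<in> unit_ball_tuples m"
  shows "\<bar>U x\<bar> \<le> form_norm m U"
  unfolding form_norm_def
  by (rule cSUP_upper[OF assms(3) bdd_above_continuous_multilinear_form[OF assms(1,2)]])

text \<open>
  The left-hand side is the value of \<open>U\<close> at the tuple whose \<open>i\<close>-th entry is the combination of the
  basis vectors with the signs of the terms as coefficients.
\<close>

lemma sum_units_le_form_norm:
  assumes U: "continuous_multilinear_form m U" and i: "i \<in> {1..m}" and x: "x \<in> unit_ball_tuples m"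
  shows "(\<Sum>n<N. \<bar>U (x(i := c0_unit n))\<bar>) \<le> form_norm m U"
proof -
  have ml: "multilinear_form m U"
    using U by (simp add: continuous_multilinear_form_def)
  have x': "x \<in> {1..m} \<rightarrow>\<^sub>E UNIV"
    using x by (auto simp: PiE_iff)
  define s where "s n = sgn (U (x(i := c0_unit n)))" for n
  have "(\<Sum>n<N. \<bar>U (x(i := c0_unit n))\<bar>) = U (x(i := \<Sum>n<N. s n *\<^sub>R c0_unit n))"
    by (simp add: multilinear_form_unit_combination[OF ml x' i] s_def sgn_mult_self_eq abs_sgn mult.commute)
  also have "\<dots> \<le> \<bar>\<dots>\<bar>"
    by simp
  also have "\<dots> \<le> form_norm m U"
  proof (rule form_norm_upper[OF U])
    have "norm (\<Sum>n<N. s n *\<^sub>R c0_unit n) \<le> 1"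
      by (rule norm_unit_combination_le) (simp add: s_def abs_sgn_eq)
    then show "x(i := \<Sum>n<N. s n *\<^sub>R c0_unit n) \<in> unit_ball_tuples m"
      by (intro fun_upd_in_PiE[OF x i]) simp
  qed (use i in auto)
  finally show ?thesis .
qed

section \<open>The mixed Littlewood inequality\<close>

lemma L2_set_PiE_insert:
  assumes "finite K" "k \<notin> K" "finite T"
  shows "L2_set f (insert k K \<rightarrow>\<^sub>E T) = L2_set (\<lambda>g. L2_set (\<lambda>l. f (g(k := l))) T) (K \<rightarrow>\<^sub>E T)"
proof -
  have "(\<Sum>j\<in>insert k K \<rightarrow>\<^sub>E T. (f j)\<^sup>2) = (\<Sum>(l, g)\<in>T \<times> (K \<rightarrow>\<^sub>E T). (f (g(k := l)))\<^sup>2)"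
    unfolding PiE_insert_eq
    by (subst sum.reindex[OF inj_combinator[OF assms(2)]]) (simp add: case_prod_unfold)
  also have "\<dots> = (\<Sum>g\<in>K \<rightarrow>\<^sub>E T. \<Sum>l\<in>T. (f (g(k := l)))\<^sup>2)"
    by (simp add: sum.cartesian_product[symmetric] sum.swap[of _ T])
  finally show ?thesis
    by (simp add: L2_set_def sum_nonneg)
qed

text \<open>
  Induction on the set \<open>K\<close> of coordinates that run through basis vectors, for all values \<open>x\<close> of the
  remaining coordinates at once.  In the step, the new coordinate \<open>k\<close> is averaged over sign
  combinations of basis vectors; for each choice of signs the induction hypothesis applies to \<open>x\<close>
  with that combination put in place \<open>k\<close>.
\<close>

lemma finite_mixed_littlewood:
  fixes U :: "(nat \<Rightarrow> c0) \<Rightarrow> real"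
  assumes U: "multilinear_form m U" and i: "i \<in> {1..m}"
    and bound: "\<And>x. x \<in> unit_ball_tuples m \<Longrightarrow> (\<Sum>n<N. \<bar>U (x(i := c0_unit n))\<bar>) \<le> M"
    and K: "K \<subseteq> {1..m} - {i}" and x: "x \<in> unit_ball_tuples m"
  shows "L2_set (\<lambda>j. \<Sum>n<N. \<bar>U ((\<lambda>k. if k \<in> K then c0_unit (j k) else x k)(i := c0_unit n))\<bar>)
      (K \<rightarrow>\<^sub>E {..<p}) \<le> sqrt 2 ^ card K * M"
proof -
  define F where "F x = (\<Sum>n<N. \<bar>U (x(i := c0_unit n))\<bar>)" for x
  define sub where "sub K j x = (\<lambda>k. if k \<in> K then c0_unit (j k) else x k)"
    for K and j :: "nat \<Rightarrow> nat" and x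
  have "finite K"
    using K finite_subset by blast
  then have "L2_set (\<lambda>j. F (sub K j x)) (K \<rightarrow>\<^sub>E {..<p}) \<le> sqrt 2 ^ card K * M"
    using K x
  proof (induction K arbitrary: x)
    case empty
    have "F x \<ge> 0"
      by (simp add: F_def sum_nonneg)
    then show ?case
      using bound[OF empty.prems(2)] by (simp add: sub_def F_def)
  next
    case (insert k K)
    define v :: "(nat \<Rightarrow> real) \<Rightarrow> c0" where "v s = (\<Sum>l<p. s l *\<^sub>R c0_unit l)" for s
    let ?E = "rademacher_mean p"
    have k: "k \<in> {1..m}" "k \<noteq> i"
      using insert.prems by auto
    have upd: "(sub K g x)(k := w) = sub K g (x(k := w))" for g w
      using insert.hyps by (auto simp: sub_def)
    have sub_upd: "sub (insert k K) (g(k := l)) x = (sub K g x)(k := c0_unit l)" for g l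
      using insert.hyps by (auto simp: sub_def)
    have one_step: "L2_set (\<lambda>l. F (y(k := c0_unit l))) {..<p} \<le> sqrt 2 * ?E (\<lambda>s. F (y(k := v s)))"
      if y: "y \<in> {1..m} \<rightarrow>\<^sub>E UNIV" for y
    proof -
      have "U (y(k := v s, i := c0_unit n)) = (\<Sum>l<p. s l * U (y(k := c0_unit l, i := c0_unit n)))" for s n
      proof -
        have "y(i := c0_unit n) \<in> {1..m} \<rightarrow>\<^sub>E UNIV"
          by (rule fun_upd_in_PiE[OF y i]) simp
        from multilinear_form_unit_combination[OF U this k(1), of s p] show ?thesis
          using k(2) by (simp add: v_def fun_upd_twist[of i k])
      qed
      then show ?thesis
        using L1_valued_khinchine[where B = "{..<N}" and p = p
            and a = "\<lambda>l n. U (y(k := c0_unit l, i := c0_unit n))"]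
        by (simp add: F_def)
    qed
    have sub_in: "sub K g x \<in> {1..m} \<rightarrow>\<^sub>E UNIV" for g
      using insert.prems by (auto simp: sub_def PiE_iff extensional_def)
    have "L2_set (\<lambda>j. F (sub (insert k K) j x)) (insert k K \<rightarrow>\<^sub>E {..<p})
        = L2_set (\<lambda>g. L2_set (\<lambda>l. F ((sub K g x)(k := c0_unit l))) {..<p}) (K \<rightarrow>\<^sub>E {..<p})"
      using insert.hyps by (simp add: L2_set_PiE_insert sub_upd)
    also have "\<dots> \<le> L2_set (\<lambda>g. sqrt 2 * ?E (\<lambda>s. F ((sub K g x)(k := v s)))) (K \<rightarrow>\<^sub>E {..<p})"
      by (intro L2_set_mono one_step sub_in) auto
    also have "\<dots> = sqrt 2 * L2_set (\<lambda>g. ?E (\<lambda>s. F ((sub K g x)(k := v s)))) (K \<rightarrow>\<^sub>E {..<p})"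
      by (simp add: L2_set_right_distrib)
    also have "\<dots> \<le> sqrt 2 * ?E (\<lambda>s. L2_set (\<lambda>g. F (sub K g (x(k := v s)))) (K \<rightarrow>\<^sub>E {..<p}))"
      unfolding upd by (intro mult_left_mono L2_set_rademacher_mean_le) auto
    also have "\<dots> \<le> sqrt 2 * ?E (\<lambda>s. sqrt 2 ^ card K * M)"
    proof (intro mult_left_mono rademacher_mean_mono insert.IH)
      fix s assume "s \<in> sign_vectors p"
      then have "norm (v s) \<le> 1"
        unfolding v_def by (intro norm_unit_combination_le) auto
      then show "x(k := v s) \<in> unit_ball_tuples m"
        by (intro fun_upd_in_PiE insert.prems k) simp
    qed (use insert.prems in auto)
    finally show ?case
      using insert.hyps by simp
  qed
  then show ?thesis
    by (simp add: F_def sub_def)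
qed

lemma nonneg_summable_on_nat:
  fixes f :: "nat \<Rightarrow> real"
  assumes nonneg: "\<And>n. f n \<ge> 0" and bound: "\<And>N. (\<Sum>n<N. f n) \<le> M"
  shows "f summable_on UNIV" and "(\<lambda>N. \<Sum>n<N. f n) \<longlonglongrightarrow> (\<Sum>\<^sub>\<infinity>n. f n)"
proof -
  have "summable f"
    by (rule summableI_nonneg_bounded[OF nonneg bound])
  then show "f summable_on UNIV"
    using nonneg summable_on_UNIV_nonneg_real_iff by blast
  then have "f sums (\<Sum>\<^sub>\<infinity>n. f n)"
    by (intro has_sum_imp_sums) auto
  then show "(\<lambda>N. \<Sum>n<N. f n) \<longlonglongrightarrow> (\<Sum>\<^sub>\<infinity>n. f n)"
    by (simp add: sums_def)
qed

lemma unit_tuple_in_ball: "unit_tuple m j \<in> unit_ball_tuples m"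
  using norm_c0_unit_le by (auto simp: unit_tuple_def)

lemma unit_tuple_upd: "i \<in> {1..m} \<Longrightarrow> unit_tuple m (j(i := n)) = (unit_tuple m j)(i := c0_unit n)"
  by (auto simp: unit_tuple_def)

lemma inner_sum_converges:
  assumes U: "continuous_multilinear_form m U" and i: "i \<in> {1..m}"
  shows "(\<lambda>n. \<bar>U (unit_tuple m (j(i := n)))\<bar>) summable_on UNIV"
    and "(\<lambda>N. \<Sum>n<N. \<bar>U (unit_tuple m (j(i := n)))\<bar>) \<longlonglongrightarrow> inner_sum m i U j"
proof -
  have bound: "(\<Sum>n<N. \<bar>U (unit_tuple m (j(i := n)))\<bar>) \<le> form_norm m U" for N
    using sum_units_le_form_norm[OF U i unit_tuple_in_ball] by (simp add: unit_tuple_upd[OF i])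
  show "(\<lambda>n. \<bar>U (unit_tuple m (j(i := n)))\<bar>) summable_on UNIV"
    "(\<lambda>N. \<Sum>n<N. \<bar>U (unit_tuple m (j(i := n)))\<bar>) \<longlonglongrightarrow> inner_sum m i U j"
    unfolding inner_sum_def by (rule nonneg_summable_on_nat[OF _ bound]; simp)+
qed

text \<open>
  The bound for finite boxes does not depend on the box, so it passes to the limit: a finite set of
  index tuples lies in some \<open>K \<rightarrow>\<^sub>E {..<p}\<close>, and on it the inner sums are limits of their partial
  sums, so every finite partial sum of the outer series inherits the bound.
\<close>

theorem mixed_littlewood_sqrt2:
  assumes U: "continuous_multilinear_form m U" and i: "i \<in> {1..m}"
  shows "mixed_littlewood m i (sqrt 2 ^ (m - 1)) U"
proof -
  define K where "K = {1..m} - {i}"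
  define M where "M = form_norm m U"
  define C where "C = sqrt 2 ^ (m - 1) * M"
  have ml: "multilinear_form m U"
    using U by (simp add: continuous_multilinear_form_def)
  have cardK: "card K = m - 1"
    using i by (simp add: K_def)
  have finK: "finite K"
    by (simp add: K_def)
  have M: "M \<ge> 0"
    using form_norm_upper[OF U _ unit_tuple_in_ball[of m "\<lambda>_. 0"]] i by (auto simp: M_def)
  have C: "C \<ge> 0"
    using M by (simp add: C_def)
  have box: "(\<Sum>j\<in>K \<rightarrow>\<^sub>E {..<p}. (\<Sum>n<N. \<bar>U (unit_tuple m (j(i := n)))\<bar>)\<^sup>2) \<le> C\<^sup>2" for p N
  proof -
    \<comment> \<open>\<open>K\<close> and \<open>i\<close> exhaust the coordinates, so every tuple in the ball can serve as base point\<close>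
    have eq: "unit_tuple m (j(i := n))
        = (\<lambda>k. if k \<in> K then c0_unit (j k) else unit_tuple m (\<lambda>_. 0) k)(i := c0_unit n)" for j n
      using i by (auto simp: K_def unit_tuple_def)
    have "L2_set (\<lambda>j. \<Sum>n<N. \<bar>U (unit_tuple m (j(i := n)))\<bar>) (K \<rightarrow>\<^sub>E {..<p}) \<le> C"
      unfolding eq C_def M_def cardK[symmetric]
      by (rule finite_mixed_littlewood[OF ml i sum_units_le_form_norm[OF U i] _ unit_tuple_in_ball])
        (auto simp: K_def)
    then show ?thesis
      unfolding L2_set_def by (rule sqrt_le_D)
  qed
  have partial: "(\<Sum>j\<in>A. (inner_sum m i U j)\<^sup>2) \<le> C\<^sup>2"
    if A: "A \<subseteq> K \<rightarrow>\<^sub>E UNIV" "finite A" for A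
  proof -
    define p where "p = Suc (Max (insert 0 (\<Union>j\<in>A. j ` K)))"
    have "j k < p" if "j \<in> A" "k \<in> K" for j k
      using that A(2) finK unfolding p_def less_Suc_eq_le by (intro Max_ge) auto
    then have sub: "A \<subseteq> K \<rightarrow>\<^sub>E {..<p}"
      using A(1) by (auto simp: PiE_iff)
    show ?thesis
    proof (rule LIMSEQ_le_const2)
      show "(\<lambda>N. \<Sum>j\<in>A. (\<Sum>n<N. \<bar>U (unit_tuple m (j(i := n)))\<bar>)\<^sup>2)
          \<longlonglongrightarrow> (\<Sum>j\<in>A. (inner_sum m i U j)\<^sup>2)"
        by (intro tendsto_sum tendsto_power inner_sum_converges[OF U i])
      have "(\<Sum>j\<in>A. (\<Sum>n<N. \<bar>U (unit_tuple m (j(i := n)))\<bar>)\<^sup>2) \<le> C\<^sup>2" for N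
        by (rule order_trans[OF sum_mono2 box[of N p]]) (use sub finK in \<open>auto intro: finite_PiE\<close>)
      then show "\<exists>N. \<forall>n\<ge>N. (\<Sum>j\<in>A. (\<Sum>n<n. \<bar>U (unit_tuple m (j(i := n)))\<bar>)\<^sup>2) \<le> C\<^sup>2"
        by blast
    qed
  qed
  have summable: "(\<lambda>j. (inner_sum m i U j)\<^sup>2) summable_on (K \<rightarrow>\<^sub>E UNIV)"
    by (rule nonneg_bdd_above_summable_on) (use partial in \<open>auto intro!: bdd_aboveI2\<close>)
  moreover have "(\<Sum>\<^sub>\<infinity>j\<in>K \<rightarrow>\<^sub>E UNIV. (inner_sum m i U j)\<^sup>2) \<le> C\<^sup>2"
    by (rule infsum_le_finite_sums[OF summable]) (use partial in auto)
  then have "sqrt (\<Sum>\<^sub>\<infinity>j\<in>K \<rightarrow>\<^sub>E UNIV. (inner_sum m i U j)\<^sup>2) \<le> C"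
    using C by (rule real_le_lsqrt[rotated])
  ultimately show ?thesis
    unfolding mixed_littlewood_def K_def[symmetric] C_def[symmetric] M_def[symmetric]
    using inner_sum_converges(1)[OF U i] C_def M_def by auto
qed

section \<open>Sharpness\<close>

text \<open>
  A sign pattern on \<open>K\<close> is given by the set \<open>A\<close> where it is negative; the injection \<open>set_encode\<close>
  turns patterns into indices of basis vectors.  For \<open>K = {1}\<close> and \<open>i = 2\<close>, it is Littlewood's
  bilinear form \<open>y\<^sub>0 (x\<^sub>0 + x\<^sub>1) + y\<^sub>2 (x\<^sub>0 - x\<^sub>1)\<close>.
\<close>

definition hypercube_form :: "nat set \<Rightarrow> nat \<Rightarrow> (nat \<Rightarrow> c0) \<Rightarrow> real" where
  "hypercube_form K i x = (\<Sum>A\<in>Pow K. c0_nth (x i) (set_encode A) *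
     (\<Prod>k\<in>K. c0_nth (x k) 0 + (if k \<in> A then - 1 else 1) * c0_nth (x k) 1))"

lemma continuous_c0_nth: "continuous_on UNIV (\<lambda>x. c0_nth x n)"
proof -
  have "bounded_linear (\<lambda>x. c0_nth x n)"
    by (rule bounded_linear_intro[where K = 1]) (auto simp: c0_nth_le_norm)
  then show ?thesis
    by (rule linear_continuous_on)
qed

lemma continuous_multilinear_hypercube_form:
  assumes i: "i \<in> {1..m}"
  shows "continuous_multilinear_form m (hypercube_form ({1..m} - {i}) i)"
proof -
  define K where "K = {1..m} - {i}"
  have K: "finite K" "i \<notin> K" "insert i K = {1..m}"
    using i by (auto simp: K_def)
  have summand: "linear (\<lambda>v. c0_nth ((x(k := v)) i) n *
      (\<Prod>l\<in>K. c0_nth ((x(k := v)) l) 0 + e l * c0_nth ((x(k := v)) l) 1))"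
    if k: "k \<in> {1..m}" for x k n and e :: "nat \<Rightarrow> real"
  proof -
    define P where "P L y = (\<Prod>l\<in>L. c0_nth (y l) 0 + e l * c0_nth (y l) 1)" for L y
    have P_upd: "P L (x(k := v)) = P L x" if "k \<notin> L" for L v
      unfolding P_def by (rule prod.cong) (use that in auto)
    have "linear (\<lambda>v. c0_nth ((x(k := v)) i) n * P K (x(k := v)))"
    proof (cases "k = i")
      case True
      then have "P K (x(k := v)) = P K x" for v
        using K(2) by (intro P_upd) simp
      then show ?thesis
        using True by (intro linearI) (simp_all add: distrib_right)
    next
      case False
      then have kK: "k \<in> K"
        using k K(3) by blast
      have "P K (x(k := v)) = (c0_nth v 0 + e k * c0_nth v 1) * P (K - {k}) (x(k := v))" for v
        unfolding P_def by (subst prod.remove[OF K(1) kK]) simp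
      then have "P K (x(k := v)) = (c0_nth v 0 + e k * c0_nth v 1) * P (K - {k}) x" for v
        using P_upd[of "K - {k}" v] by simp
      then show ?thesis
        using False by (intro linearI) (simp_all add: algebra_simps)
    qed
    then show ?thesis
      by (simp only: P_def)
  qed
  have "linear (\<lambda>v. hypercube_form K i (x(k := v)))" if "k \<in> {1..m}" for x k
    unfolding hypercube_form_def
    by (rule linear_compose_sum, rule ballI, rule summand[OF that])
  then have "multilinear_form m (hypercube_form K i)"
    by (simp add: multilinear_form_def)
  moreover have coord: "continuous_map (product_topology (\<lambda>_. euclidean) {1..m}) euclideanreal
      (\<lambda>x. c0_nth (x k) n)" if "k \<in> {1..m}" for k n
    using continuous_map_compose[OF continuous_map_product_projection[OF that, of "\<lambda>_. euclidean"],
        of euclideanreal "\<lambda>v. c0_nth v n"] continuous_c0_nth[of n]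
    by (simp add: o_def)
  have "continuous_map (product_topology (\<lambda>_. euclidean) {1..m}) euclideanreal (hypercube_form K i)"
    unfolding hypercube_form_def
    by (intro continuous_map_sum continuous_map_real_mult continuous_map_prod continuous_map_add
        continuous_map_canonical_const coord) (use K in auto)
  ultimately show ?thesis
    by (simp add: continuous_multilinear_form_def K_def)
qed

text \<open>
  Expanding the product of \<open>\<bar>a\<^sub>k - b\<^sub>k\<bar> + \<bar>a\<^sub>k + b\<^sub>k\<bar>\<close> over \<open>k \<in> K\<close> yields the sum over all sign
  patterns of the absolute values of the products, and each factor is at most \<open>2\<close>.
\<close>

lemma hypercube_form_le:
  assumes K: "finite K" and x: "\<And>k. k \<in> insert i K \<Longrightarrow> norm (x k) \<le> 1"
  shows "\<bar>hypercube_form K i x\<bar> \<le> 2 ^ card K"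
proof -
  let ?a = "\<lambda>k. c0_nth (x k) 0" and ?b = "\<lambda>k. c0_nth (x k) 1"
  have coord: "\<bar>c0_nth (x k) n\<bar> \<le> 1" if "k \<in> insert i K" for k n
    using c0_nth_le_norm[of "x k" n] x[OF that] by linarith
  have "\<bar>hypercube_form K i x\<bar>
      \<le> (\<Sum>A\<in>Pow K. \<Prod>k\<in>K. \<bar>?a k + (if k \<in> A then - 1 else 1) * ?b k\<bar>)"
    unfolding hypercube_form_def
  proof (rule order_trans[OF sum_abs sum_mono])
    fix A
    show "\<bar>c0_nth (x i) (set_encode A) * (\<Prod>k\<in>K. ?a k + (if k \<in> A then - 1 else 1) * ?b k)\<bar>
        \<le> (\<Prod>k\<in>K. \<bar>?a k + (if k \<in> A then - 1 else 1) * ?b k\<bar>)"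
      unfolding abs_mult abs_prod
      by (rule mult_left_le_one_le) (auto simp: coord intro: prod_nonneg)
  qed
  also have "\<dots> = (\<Sum>A\<in>Pow K. (\<Prod>k\<in>A. \<bar>?a k - ?b k\<bar>) * (\<Prod>k\<in>K - A. \<bar>?a k + ?b k\<bar>))"
  proof (rule sum.cong)
    fix A assume "A \<in> Pow K"
    then show "(\<Prod>k\<in>K. \<bar>?a k + (if k \<in> A then - 1 else 1) * ?b k\<bar>)
        = (\<Prod>k\<in>A. \<bar>?a k - ?b k\<bar>) * (\<Prod>k\<in>K - A. \<bar>?a k + ?b k\<bar>)"
      using K by (subst prod.subset_diff[of A K]) (auto simp: mult.commute)
  qed simp
  also have "\<dots> = (\<Prod>k\<in>K. \<bar>?a k - ?b k\<bar> + \<bar>?a k + ?b k\<bar>)"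
    by (rule prod_add[OF K, symmetric])
  also have "\<dots> \<le> (\<Prod>k\<in>K. 2)"
  proof (rule prod_mono)
    fix k assume "k \<in> K"
    then have "\<bar>?a k\<bar> \<le> 1" "\<bar>?b k\<bar> \<le> 1"
      by (auto intro: coord)
    then show "0 \<le> \<bar>?a k - ?b k\<bar> + \<bar>?a k + ?b k\<bar> \<and> \<bar>?a k - ?b k\<bar> + \<bar>?a k + ?b k\<bar> \<le> 2"
      by linarith
  qed
  finally show ?thesis by simp
qed

text \<open>
  If every \<open>j k\<close> is \<open>0\<close> or \<open>1\<close>, the coefficient of each of the \<open>2 ^ (m - 1)\<close> patterns is a product
  of signs, so it contributes exactly \<open>1\<close> to the inner sum.
\<close>

lemma inner_sum_hypercube_form:
  assumes i: "i \<in> {1..m}" and j: "j \<in> ({1..m} - {i}) \<rightarrow>\<^sub>E {..<2}"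
  shows "inner_sum m i (hypercube_form ({1..m} - {i}) i) j = 2 ^ (m - 1)"
proof -
  define K where "K = {1..m} - {i}"
  have K: "finite K" "i \<notin> K" "card K = m - 1"
    using i by (auto simp: K_def)
  have finA: "finite A" if "A \<in> Pow K" for A
    using that K(1) finite_subset by blast
  define c where "c A = (\<Prod>k\<in>K. c0_nth (c0_unit (j k)) 0
      + (if k \<in> A then - 1 else 1) * c0_nth (c0_unit (j k)) 1)" for A
  have c: "\<bar>c A\<bar> = 1" for A
    unfolding c_def abs_prod
  proof (rule prod.neutral, rule ballI)
    fix k assume "k \<in> K"
    then have "j k < 2"
      using j by (auto simp: PiE_iff K_def)
    then have "j k = 0 \<or> j k = 1"
      by auto
    then show "\<bar>c0_nth (c0_unit (j k)) 0 + (if k \<in> A then - 1 else 1) * c0_nth (c0_unit (j k)) 1\<bar> = 1"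
      by auto
  qed
  have at_unit: "hypercube_form K i (unit_tuple m (j(i := n)))
      = (\<Sum>A\<in>Pow K. (if set_encode A = n then c A else 0))" for n
  proof -
    have "(\<Prod>k\<in>K. c0_nth (unit_tuple m (j(i := n)) k) 0
        + (if k \<in> A then - 1 else 1) * c0_nth (unit_tuple m (j(i := n)) k) 1) = c A" for A
      unfolding c_def by (rule prod.cong) (auto simp: unit_tuple_def K_def)
    moreover have "unit_tuple m (j(i := n)) i = c0_unit n"
      using i by (simp add: unit_tuple_def)
    ultimately show ?thesis
      unfolding hypercube_form_def by (intro sum.cong) auto
  qed
  have inj: "inj_on set_encode (Pow K)"
    by (rule inj_on_subset[OF inj_on_set_encode]) (auto intro: finA)
  have at_code: "\<bar>hypercube_form K i (unit_tuple m (j(i := set_encode B)))\<bar> = 1" if B: "B \<in> Pow K" for B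
  proof -
    have "(\<Sum>A\<in>Pow K. (if set_encode A = set_encode B then c A else 0))
        = (\<Sum>A\<in>Pow K. (if A = B then c A else 0))"
      by (rule sum.cong) (use inj_on_eq_iff[OF inj _ B] in auto)
    then show ?thesis
      using B K(1) by (simp add: at_unit c)
  qed
  have off_code: "hypercube_form K i (unit_tuple m (j(i := n))) = 0" if "n \<notin> set_encode ` Pow K" for n
    unfolding at_unit by (rule sum.neutral) (use that in auto)
  have "inner_sum m i (hypercube_form K i) j
      = (\<Sum>\<^sub>\<infinity>n\<in>set_encode ` Pow K. \<bar>hypercube_form K i (unit_tuple m (j(i := n)))\<bar>)"
    unfolding inner_sum_def by (rule infsum_cong_neutral) (auto simp: off_code)
  also have "\<dots> = (\<Sum>B\<in>Pow K. \<bar>hypercube_form K i (unit_tuple m (j(i := set_encode B)))\<bar>)"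
    using K(1) by (simp add: sum.reindex[OF inj])
  also have "\<dots> = 2 ^ (m - 1)"
    using K(1,3) by (simp add: at_code card_Pow)
  finally show ?thesis
    by (simp add: K_def)
qed

text \<open>
  The \<open>2 ^ (m - 1)\<close> index tuples with entries in \<open>{0, 1}\<close> alone make the left-hand side
  at least \<open>sqrt 2 ^ (m - 1) * 2 ^ (m - 1)\<close>, whereas the form has norm at most \<open>2 ^ (m - 1)\<close>.
\<close>

lemma mixed_littlewood_constant_ge:
  assumes i: "i \<in> {1..m}"
    and C: "mixed_littlewood m i C (hypercube_form ({1..m} - {i}) i)"
  shows "sqrt 2 ^ (m - 1) \<le> C"
proof -
  define K where "K = {1..m} - {i}"
  define U where "U = hypercube_form K i"
  have K: "finite K" "card K = m - 1" "insert i K = {1..m}"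
    using i by (auto simp: K_def)
  have U: "continuous_multilinear_form m U"
    unfolding U_def K_def by (rule continuous_multilinear_hypercube_form[OF i])
  have norm_nonneg: "0 \<le> form_norm m U"
    using form_norm_upper[OF U _ unit_tuple_in_ball[of m "\<lambda>_. 0"]] i by auto
  have norm_le: "form_norm m U \<le> 2 ^ (m - 1)"
    unfolding form_norm_def
  proof (rule cSUP_least)
    show "unit_ball_tuples m \<noteq> {}"
      using unit_tuple_in_ball by blast
    fix x assume "x \<in> unit_ball_tuples m"
    then have "norm (x k) \<le> 1" if "k \<in> insert i K" for k
      using that K(3) by (auto simp: PiE_iff)
    from hypercube_form_le[OF K(1) this] show "\<bar>U x\<bar> \<le> 2 ^ (m - 1)"
      by (simp add: U_def K(2))
  qed
  have "(sqrt 2 ^ (m - 1))\<^sup>2 = (2 :: real) ^ (m - 1)"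
    by (subst power_mult[symmetric], subst mult.commute, subst power_mult) simp
  then have "(sqrt 2 ^ (m - 1) * 2 ^ (m - 1))\<^sup>2 = (2 :: real) ^ (m - 1) * (2 ^ (m - 1))\<^sup>2"
    by (simp only: power_mult_distrib)
  also have "\<dots> = (\<Sum>j\<in>K \<rightarrow>\<^sub>E {..<2 :: nat}. (2 ^ (m - 1))\<^sup>2)"
    using K(1,2) by (simp add: card_PiE)
  also have "\<dots> = (\<Sum>j\<in>K \<rightarrow>\<^sub>E {..<2}. (inner_sum m i U j)\<^sup>2)"
    unfolding U_def K_def by (intro sum.cong refl) (simp only: inner_sum_hypercube_form[OF i])
  also have "\<dots> \<le> (\<Sum>\<^sub>\<infinity>j\<in>K \<rightarrow>\<^sub>E UNIV. (inner_sum m i U j)\<^sup>2)"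
    by (rule finite_sum_le_infsum)
      (use C K(1) in \<open>auto simp: mixed_littlewood_def U_def K_def intro: finite_PiE\<close>)
  finally have "sqrt 2 ^ (m - 1) * 2 ^ (m - 1) \<le> sqrt (\<Sum>\<^sub>\<infinity>j\<in>K \<rightarrow>\<^sub>E UNIV. (inner_sum m i U j)\<^sup>2)"
    by (rule real_le_rsqrt)
  also have "\<dots> \<le> C * form_norm m U"
    using C by (simp add: mixed_littlewood_def U_def K_def)
  finally have le: "sqrt 2 ^ (m - 1) * 2 ^ (m - 1) \<le> C * form_norm m U" .
  have "C > 0"
  proof (rule ccontr)
    assume "\<not> C > 0"
    then have "C * form_norm m U \<le> 0"
      using norm_nonneg by (intro mult_nonpos_nonneg) auto
    moreover have "0 < sqrt 2 ^ (m - 1) * (2 :: real) ^ (m - 1)"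
      by simp
    ultimately show False
      using le by linarith
  qed
  with le have "sqrt 2 ^ (m - 1) * 2 ^ (m - 1) \<le> C * 2 ^ (m - 1)"
    using mult_left_mono[OF norm_le, of C] by linarith
  then show ?thesis
    by simp
qed

lemma optimal_constant_eq:
  assumes i: "i \<in> {1..m}"
  shows "optimal_constant m i = sqrt 2 ^ (m - 1)"
  unfolding optimal_constant_def
  by (rule Least_equality)
    (use i mixed_littlewood_sqrt2 mixed_littlewood_constant_ge
      continuous_multilinear_hypercube_form in blast)+

theorem theorem4p1:
  fixes m i :: nat
  assumes "m \<ge> 2" and "1 \<le> i" and "i \<le> m"
  shows "(\<forall>U. continuous_multilinear_form m U \<longrightarrow> mixed_littlewood m i (sqrt 2 ^ (m - 1)) U)
    \<and> optimal_constant m i = sqrt 2 ^ (m - 1)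
    \<and> optimal_constant m m = sqrt 2 ^ (m - 1)"
proof -
  have im: "i \<in> {1..m}" "m \<in> {1..m}"
    using assms by auto
  then show ?thesis
    using mixed_littlewood_sqrt2[OF _ im(1)] optimal_constant_eq by blast
qed

end
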